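(* If $G=(V,w,m)$ is an infinite graph with bounded vertex degree and $x_0\in V$, then the sphere curvatures with respect to $x_0$ satisfy $$\limsup_{R\to\infty}\sum_{r=1}^R\kappa(r)<\infty.$$ Consequently, there is no infinite graph with bounded vertex degree satisfying $$\limsup_{R\to\infty}\sum_{r=1}^R\kappa(r)=\infty.$$
   Context: A graph is a triple $G=(V,w,m)$ with $V$ a countable set, $w:V\times V\to[0,\infty)$ symmetric and zero on the diagonal, and $m:V\to(0,\infty)$. Write $x\sim y$ if $w(x,y)>0$. All graphs are locally finite (for each $x$ only finitely many $y$ satisfy $x\sim y$) and connected; $d(x,y)=\inf\{n: x=x_0\sim\cdots\sim x_n=y\}$ is the combinatorial distance, which is finite by connectedness. $G$ is infinite if $V$ is infinite. $\mathrm{Deg}(x)=\frac1{m(x)}\sum_{y}w(x,y)$; $G$ has bounded (vertex) degree if $\sup_x\mathrm{Deg}(x)<\infty$. $Lip(1)$ is the set of $f:V\to\mathbb R$ with $|f(x)-f(y)|\le d(x,y)$ for all $x,y$. Curvature: for $x\in V$ and $\varepsilon>0$ let $m_x^\varepsilon(x)=1-\varepsilon\,\mathrm{Deg}(x)$ and $m_x^\varepsilon(y)=\varepsilon w(x,y)/m(x)$ for $y\neq x$; this is a finitely supported probability measure for $\varepsilon$ small. For probability measures $\mu,\nu$ on $V$, $W(\mu,\nu)=\sup_{f}\sum_{x}f(x)(\mu(x)-\nu(x))$, the supremum over bounded $f\in Lip(1)$. For $x\neq y$ let $\kappa_\varepsilon(x,y)=1-\frac{W(m_x^\varepsilon,m_y^\varepsilon)}{d(x,y)}$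 and $\kappa(x,y)=\lim_{\varepsilon\to0^+}\frac1\varepsilon\kappa_\varepsilon(x,y)$ (this limit exists). Sphere curvatures with respect to a fixed vertex $x_0$: with $S_r=\{y: d(x_0,y)=r\}$, for $r\ge1$, $\kappa(r)=\min_{y\in S_r}\max_{x\in S_{r-1},\,x\sim y}\kappa(x,y)$. *)

theory Defs
  imports "HOL-Analysis.Analysis"
begin

text \<open>
  Graphs are weighted, locally finite and connected. The vertex set is a carrier set,
  and the values of \<open>w\<close> and \<open>m\<close> outside of it are irrelevant.
\<close>

locale weighted_graph =
  fixes V :: "'a set" and w :: "'a \<Rightarrow> 'a \<Rightarrow> real" and m :: "'a \<Rightarrow> real"
  assumes countable_V: "countable V"
    and w_nonneg: "\<lbrakk>x \<in> V; y \<in> V\<rbrakk> \<Longrightarrow> 0 \<le> w x y"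
    and w_sym: "\<lbrakk>x \<in> V; y \<in> V\<rbrakk> \<Longrightarrow> w x y = w y x"
    and w_diag: "x \<in> V \<Longrightarrow> w x x = 0"
    and m_pos: "x \<in> V \<Longrightarrow> 0 < m x"
    and locally_finite: "x \<in> V \<Longrightarrow> finite {y \<in> V. 0 < w x y}"
    and connected: "\<lbrakk>x \<in> V; y \<in> V\<rbrakk> \<Longrightarrow> (x, y) \<in> {(u, v). u \<in> V \<and> v \<in> V \<and> 0 < w u v}\<^sup>*"
begin

definition adj :: "('a \<times> 'a) set" where
  "adj = {(x, y). x \<in> V \<and> y \<in> V \<and> 0 < w x y}"

definition d :: "'a \<Rightarrow> 'a \<Rightarrow> nat" where
  "d x y = Inf {n. (x, y) \<in> adj ^^ n}"

text \<open>By local finiteness, only finitely many terms of the following sum are nonzero.\<close>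

definition Deg :: "'a \<Rightarrow> real" where
  "Deg x = (1 / m x) * (\<Sum>\<^sub>\<infinity>y\<in>V. w x y)"

definition bounded_degree :: bool where
  "bounded_degree \<longleftrightarrow> bdd_above (Deg ` V)"

definition Lip1 :: "('a \<Rightarrow> real) set" where
  "Lip1 = {f. \<forall>x\<in>V. \<forall>y\<in>V. \<bar>f x - f y\<bar> \<le> real (d x y)}"

text \<open>
  Measures on \<open>V\<close> are given by their point masses. For large \<open>\<epsilon>\<close> the mass of
  \<open>walk_measure \<epsilon> x\<close> at \<open>x\<close> is negative; only the limit \<open>\<epsilon> \<rightarrow> 0\<close> is used below.
\<close>

definition walk_measure :: "real \<Rightarrow> 'a \<Rightarrow> 'a \<Rightarrow> real" where
  "walk_measure \<epsilon> x y = (if y = x then 1 - \<epsilon> * Deg x else \<epsilon> * w x y / m x)"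

text \<open>
  A supremum in the reals: for finitely supported measures of equal total mass, such as
  those below, the set of values is bounded above.
\<close>

definition W :: "('a \<Rightarrow> real) \<Rightarrow> ('a \<Rightarrow> real) \<Rightarrow> real" where
  "W \<mu> \<nu> = (SUP f\<in>{f \<in> Lip1. bounded (f ` V)}. \<Sum>\<^sub>\<infinity>x\<in>V. f x * (\<mu> x - \<nu> x))"

definition curvature_eps :: "real \<Rightarrow> 'a \<Rightarrow> 'a \<Rightarrow> real" where
  "curvature_eps \<epsilon> x y = 1 - W (walk_measure \<epsilon> x) (walk_measure \<epsilon> y) / real (d x y)"

definition curvature :: "'a \<Rightarrow> 'a \<Rightarrow> real" where
  "curvature x y = Lim (at_right 0) (\<lambda>\<epsilon>. (1 / \<epsilon>) * curvature_eps \<epsilon> x y)"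

definition S :: "'a \<Rightarrow> nat \<Rightarrow> 'a set" where
  "S x0 r = {y \<in> V. d x0 y = r}"

text \<open>
  Meaningful for \<open>r \<ge> 1\<close>. In an infinite graph the sets over which the minimum and the
  maximum are taken are then finite and nonempty.
\<close>

definition sphere_curvature :: "'a \<Rightarrow> nat \<Rightarrow> real" where
  "sphere_curvature x0 r =
     (MIN y\<in>S x0 r. MAX x\<in>{x \<in> S x0 (r - 1). (x, y) \<in> adj}. curvature x y)"

end

end

theory Submission
  imports Defs
begin

text \<open>
  Let \<open>\<Delta> f x = (1 / m x) * (\<Sum>y. w x y * (f y - f x))\<close>. Testing the transport distance against
  (a truncation of) \<open>-f\<close> gives \<open>d x y * \<kappa>(x, y) \<le> \<Delta> f x - \<Delta> f y\<close> for every 1-Lipschitz \<open>f\<close>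
  with \<open>f y - f x = d x y\<close>. For \<open>f = d x0\<close>, following neighbours of maximal curvature from a vertex
  \<open>y\<close> of the sphere of radius \<open>R\<close> down to \<open>x0\<close> and telescoping yields
  \<open>\<Delta> f y \<le> Deg x0 - (\<Sum>r=1..R. \<kappa>(r))\<close>. Since \<open>\<Delta> f y \<ge> - Deg y\<close>, the partial sums
  are at most twice the degree bound.
\<close>

context weighted_graph
begin

section \<open>Neighbourhoods, Laplacian and degree as finite sums\<close>

definition neighbors :: "'a \<Rightarrow> 'a set" where
  "neighbors x = {y \<in> V. 0 < w x y}"

text \<open>Summing over \<open>neighbors x\<close> instead of \<open>V\<close> keeps the sum
  finite, so no summability argument is needed.\<close>

definition laplacian :: "('a \<Rightarrow> real) \<Rightarrow> 'a \<Rightarrow> real" where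
  "laplacian f x = (1 / m x) * (\<Sum>y\<in>neighbors x. w x y * (f y - f x))"

lemma finite_neighbors: "x \<in> V \<Longrightarrow> finite (neighbors x)"
  unfolding neighbors_def by (rule locally_finite)

lemma neighbors_subset: "neighbors x \<subseteq> V"
  by (auto simp: neighbors_def)

lemma not_neighbor_self: "x \<in> V \<Longrightarrow> x \<notin> neighbors x"
  by (simp add: neighbors_def w_diag)

lemma w_eq_0: "\<lbrakk>x \<in> V; y \<in> V; y \<notin> neighbors x\<rbrakk> \<Longrightarrow> w x y = 0"
  using w_nonneg[of x y] by (auto simp: neighbors_def)

lemma sym_adj: "sym adj"
  using w_sym by (intro symI) (auto simp: adj_def)

lemma Deg_eq: assumes "x \<in> V" shows "Deg x = (1 / m x) * (\<Sum>y\<in>neighbors x. w x y)"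
proof -
  have "infsum (w x) V = infsum (w x) (neighbors x)"
    using assms neighbors_subset[of x] w_eq_0[of x] by (intro infsum_cong_neutral) auto
  then show ?thesis by (simp add: Deg_def finite_neighbors assms)
qed

subsection \<open>The combinatorial distance\<close>

text \<open>Connectedness makes the set of path lengths nonempty, so its infimum in the naturals is
  attained and is not a default value.\<close>

lemma adj_pow_d: assumes "x \<in> V" "y \<in> V" shows "(x, y) \<in> adj ^^ d x y"
proof -
  have "(x, y) \<in> adj\<^sup>*"
    using connected[OF assms] unfolding adj_def .
  then obtain n where "(x, y) \<in> adj ^^ n"
    using rtrancl_imp_relpow by blast
  then have "Inf {n. (x, y) \<in> adj ^^ n} \<in> {n. (x, y) \<in> adj ^^ n}"
    by (intro Inf_nat_def1) auto
  then show ?thesis unfolding d_def by (rule CollectD)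
qed

lemma d_le: "(x, y) \<in> adj ^^ n \<Longrightarrow> d x y \<le> n"
  unfolding d_def by (rule cInf_lower) auto

lemma d_self [simp]: "d x x = 0"
  using d_le[of x x 0] by simp

lemma d_eq_0_iff: "\<lbrakk>x \<in> V; y \<in> V\<rbrakk> \<Longrightarrow> d x y = 0 \<longleftrightarrow> x = y"
  using adj_pow_d[of x y] by auto

lemma d_triangle: assumes "x \<in> V" "y \<in> V" "z \<in> V" shows "d x z \<le> d x y + d y z"
proof -
  have "(x, z) \<in> adj ^^ (d x y + d y z)"
    using adj_pow_d[of x y] adj_pow_d[of y z] assms by (auto simp: relpow_add)
  then show ?thesis by (rule d_le)
qed

lemma d_adj: assumes "(x, y) \<in> adj" shows "d x y = 1"
proof -
  have "x \<in> V" "y \<in> V" and "x \<noteq> y"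
    using assms w_diag by (auto simp: adj_def)
  then have "d x y \<noteq> 0" by (simp add: d_eq_0_iff)
  moreover have "d x y \<le> 1" using d_le[of x y 1] assms by simp
  ultimately show ?thesis by simp
qed

lemma d_sym: assumes "x \<in> V" "y \<in> V" shows "d x y = d y x"
proof -
  \<comment> \<open>Path reversal: the first edge is peeled off and becomes the last one of the
    reversed path.\<close>
  have "(u, v) \<in> adj ^^ n \<Longrightarrow> (v, u) \<in> adj ^^ n" for u v n
  proof (induction n arbitrary: u)
    case (Suc n)
    then obtain z where "(u, z) \<in> adj" "(z, v) \<in> adj ^^ n"
      using relpow_Suc_D2 by metis
    then show ?case using Suc.IH symD[OF sym_adj] relpow_Suc_I by metis
  qed simp
  then show ?thesis
    using adj_pow_d assms d_le by (metis antisym)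
qed

lemma d_in_Lip1: assumes "x0 \<in> V" shows "(\<lambda>y. real (d x0 y)) \<in> Lip1"
  unfolding Lip1_def
proof (intro CollectI ballI)
  fix x y assume "x \<in> V" "y \<in> V"
  then have "d x0 x \<le> d x0 y + d x y" "d x0 y \<le> d x0 x + d x y"
    using d_triangle[of x0 y x] d_triangle[of x0 x y] d_sym[of x y] assms by auto
  then show "\<bar>real (d x0 x) - real (d x0 y)\<bar> \<le> real (d x y)" by linarith
qed

section \<open>Spheres around a vertex\<close>

lemma sphere_pred:
  assumes "x0 \<in> V" "y \<in> S x0 (Suc r)"
  obtains x where "x \<in> S x0 r" "(x, y) \<in> adj"
proof -
  have y: "y \<in> V" "d x0 y = Suc r" using assms by (auto simp: S_def)
  \<comment> \<open>Cutting the last edge off a shortest path from \<open>x0\<close> to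
    \<open>y\<close> produces \<open>x\<close>.\<close>
  then obtain x where x: "(x0, x) \<in> adj ^^ r" "(x, y) \<in> adj"
    using adj_pow_d[of x0 y] assms by auto
  have "x \<in> V" using x by (auto simp: adj_def)
  moreover have "d x0 x \<le> r" using x by (intro d_le)
  moreover have "d x0 y \<le> d x0 x + 1"
    using d_triangle[of x0 x y] d_adj[of x y] x y \<open>x \<in> V\<close> assms by simp
  ultimately have "x \<in> S x0 r" using y by (simp add: S_def)
  then show thesis using that x by blast
qed

text \<open>Each sphere lies in the union of the finite neighbourhoods of the previous one.
  Finiteness is what makes the minimum and maximum in \<open>sphere_curvature\<close>
  meaningful.\<close>

lemma finite_sphere: assumes "x0 \<in> V" shows "finite (S x0 r)"
proof (induction r)
  case 0
  have "S x0 0 \<subseteq> {x0}" using assms by (auto simp: S_def d_eq_0_iff)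
  then show ?case by (rule finite_subset) simp
next
  case (Suc r)
  have "S x0 (Suc r) \<subseteq> (\<Union>x\<in>S x0 r. neighbors x)"
  proof
    fix y assume "y \<in> S x0 (Suc r)"
    then obtain x where "x \<in> S x0 r" "(x, y) \<in> adj" using sphere_pred assms by blast
    then show "y \<in> (\<Union>x\<in>S x0 r. neighbors x)" by (auto simp: adj_def neighbors_def)
  qed
  moreover have "finite (\<Union>x\<in>S x0 r. neighbors x)"
    using Suc by (auto simp: S_def finite_neighbors)
  ultimately show ?case by (rule finite_subset)
qed

text \<open>After an empty sphere all later ones are empty, since their vertices have predecessors;
  then \<open>V\<close> would be a finite union of finite spheres. Infinitude of the graph enters
  here.\<close>

lemma sphere_nonempty: assumes "x0 \<in> V" "infinite V" shows "S x0 r \<noteq> {}"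
proof
  assume empty: "S x0 r = {}"
  have "S x0 (r + k) = {}" for k
  proof (induction k)
    case (Suc k)
    then show ?case using sphere_pred[OF assms(1), of _ "r + k"] by auto
  qed (simp add: empty)
  then have "d x0 y < r" if "y \<in> V" for y
    using that le_Suc_ex[of r "d x0 y"] by (fastforce simp: S_def not_le[symmetric])
  then have "V \<subseteq> (\<Union>k<r. S x0 k)" by (auto simp: S_def)
  moreover have "finite (\<Union>k<r. S x0 k)" using finite_sphere[OF assms(1)] by blast
  ultimately show False using assms(2) finite_subset by blast
qed

subsection \<open>The Laplacian and the transport distance\<close>

text \<open>Adjacent vertices have distance 1, so \<open>f\<close> changes by at most 1 along each
  edge at \<open>x\<close>.\<close>

lemma abs_laplacian_le_Deg:
  assumes "f \<in> Lip1" "x \<in> V" shows "\<bar>laplacian f x\<bar> \<le> Deg x"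
proof -
  have "\<bar>\<Sum>y\<in>neighbors x. w x y * (f y - f x)\<bar> \<le> (\<Sum>y\<in>neighbors x. w x y)"
  proof (rule order.trans[OF sum_abs sum_mono])
    fix y assume y: "y \<in> neighbors x"
    then have "d x y = 1" "y \<in> V" "0 < w x y" using assms d_adj by (auto simp: adj_def neighbors_def)
    then have "\<bar>f y - f x\<bar> \<le> 1" using assms by (fastforce simp: Lip1_def abs_minus_commute)
    then show "\<bar>w x y * (f y - f x)\<bar> \<le> w x y"
      using \<open>0 < w x y\<close> by (simp add: abs_mult mult_left_le)
  qed
  then show ?thesis
    using m_pos[OF assms(2)] by (simp add: laplacian_def Deg_eq assms abs_mult divide_right_mono)
qed

lemma laplacian_uminus: "laplacian (\<lambda>z. - f z) x = - laplacian f x"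
proof -
  have "w x y * (- f y - - f x) = - (w x y * (f y - f x))" for y
    by (simp add: algebra_simps)
  then show ?thesis by (simp only: laplacian_def sum_negf mult_minus_right)
qed

lemma laplacian_cong:
  "(\<And>z. z \<in> insert x (neighbors x) \<Longrightarrow> f z = g z) \<Longrightarrow> laplacian f x = laplacian g x"
  by (simp add: laplacian_def)

text \<open>The mean of \<open>f\<close> after one step of the lazy walk is exactly affine in
  \<epsilon>, with slope the Laplacian. \<open>F\<close> may exceed the support so that two walks
  can share one set.\<close>

lemma sum_walk_measure:
  assumes "x \<in> V" "finite F" "F \<subseteq> V" "insert x (neighbors x) \<subseteq> F"
  shows "(\<Sum>z\<in>F. f z * walk_measure \<epsilon> x z) = f x + \<epsilon> * laplacian f x"
proof -
  have "(\<Sum>z\<in>F. f z * walk_measure \<epsilon> x z) = (\<Sum>z\<in>insert x (neighbors x). f z * walk_measure \<epsilon> x z)"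
    using assms by (intro sum.mono_neutral_right) (auto simp: walk_measure_def w_eq_0)
  also have "\<dots> = f x * (1 - \<epsilon> * Deg x) + (\<Sum>z\<in>neighbors x. f z * (\<epsilon> * w x z / m x))"
    using assms(1) not_neighbor_self[of x]
    by (auto simp: walk_measure_def finite_neighbors intro!: sum.cong)
  also have "(\<Sum>z\<in>neighbors x. f z * (\<epsilon> * w x z / m x)) =
      \<epsilon> * ((1 / m x) * (\<Sum>z\<in>neighbors x. w x z * f z))"
    unfolding sum_distrib_left by (intro sum.cong) auto
  \<comment> \<open>Splitting \<open>f z\<close> as \<open>(f z - f x) + f x\<close> produces a
    degree term that cancels the mass lost at \<open>x\<close>.\<close>
  also have "(\<Sum>z\<in>neighbors x. w x z * f z) =
      (\<Sum>z\<in>neighbors x. w x z * (f z - f x)) + (\<Sum>z\<in>neighbors x. w x z) * f x"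
    unfolding sum_distrib_right sum.distrib[symmetric] by (intro sum.cong) (auto simp: algebra_simps)
  also have "f x * (1 - \<epsilon> * Deg x) + \<epsilon> * ((1 / m x) * \<dots>) = f x + \<epsilon> * laplacian f x"
    unfolding laplacian_def Deg_eq[OF assms(1)] by (simp add: algebra_simps add_divide_distrib)
  finally show ?thesis .
qed

lemma infsum_walk_measure_diff:
  assumes "x \<in> V" "y \<in> V"
  shows "(\<Sum>\<^sub>\<infinity>z\<in>V. f z * (walk_measure \<epsilon> x z - walk_measure \<epsilon> y z)) =
         f x - f y + \<epsilon> * (laplacian f x - laplacian f y)"
proof -
  \<comment> \<open>A common finite set carrying both measures.\<close>
  define F where "F = insert x (neighbors x) \<union> insert y (neighbors y)"
  have F: "finite F" "F \<subseteq> V"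
    using assms neighbors_subset by (auto simp: F_def finite_neighbors)
  have "(\<Sum>\<^sub>\<infinity>z\<in>V. f z * (walk_measure \<epsilon> x z - walk_measure \<epsilon> y z)) =
        (\<Sum>\<^sub>\<infinity>z\<in>F. f z * (walk_measure \<epsilon> x z - walk_measure \<epsilon> y z))"
    using F assms by (intro infsum_cong_neutral) (auto simp: F_def walk_measure_def w_eq_0)
  also have "\<dots> = (\<Sum>z\<in>F. f z * walk_measure \<epsilon> x z) - (\<Sum>z\<in>F. f z * walk_measure \<epsilon> y z)"
    using F by (simp add: right_diff_distrib sum_subtractf)
  also have "(\<Sum>z\<in>F. f z * walk_measure \<epsilon> x z) = f x + \<epsilon> * laplacian f x"
    using F assms by (intro sum_walk_measure) (auto simp: F_def)
  also have "(\<Sum>z\<in>F. f z * walk_measure \<epsilon> y z) = f y + \<epsilon> * laplacian f y"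
    using F assms by (intro sum_walk_measure) (auto simp: F_def)
  finally show ?thesis by (simp add: algebra_simps)
qed

lemma W_walk_measure:
  assumes "x \<in> V" "y \<in> V"
  shows "W (walk_measure \<epsilon> x) (walk_measure \<epsilon> y) =
    (SUP f\<in>{f \<in> Lip1. bounded (f ` V)}. f x - f y + \<epsilon> * (laplacian f x - laplacian f y))"
  by (simp add: W_def infsum_walk_measure_diff assms)

text \<open>This bound is uniform in \<open>f\<close>, so the real supremum in \<open>W\<close> is
  taken over a set bounded above.\<close>

lemma test_value_le:
  assumes "x \<in> V" "y \<in> V" "0 \<le> \<epsilon>" "f \<in> Lip1"
  shows "f x - f y + \<epsilon> * (laplacian f x - laplacian f y) \<le> real (d x y) + \<epsilon> * (Deg x + Deg y)"
proof (rule add_mono[OF _ mult_left_mono])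
  show "f x - f y \<le> real (d x y)" using assms by (fastforce simp: Lip1_def)
  show "laplacian f x - laplacian f y \<le> Deg x + Deg y"
    using abs_laplacian_le_Deg[of f x] abs_laplacian_le_Deg[of f y] assms by linarith
qed (use assms in simp)

lemma test_value_le_W:
  assumes "x \<in> V" "y \<in> V" "0 \<le> \<epsilon>" "f \<in> Lip1" "bounded (f ` V)"
  shows "f x - f y + \<epsilon> * (laplacian f x - laplacian f y) \<le> W (walk_measure \<epsilon> x) (walk_measure \<epsilon> y)"
  unfolding W_walk_measure[OF assms(1,2)]
proof (rule cSUP_upper)
  show "bdd_above ((\<lambda>f. f x - f y + \<epsilon> * (laplacian f x - laplacian f y)) ` {f \<in> Lip1. bounded (f ` V)})"
    using test_value_le[OF assms(1-3)] by (intro bdd_aboveI2) auto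
qed (use assms in simp)

lemma W_walk_measure_le:
  assumes "x \<in> V" "y \<in> V"
    and "\<And>f. \<lbrakk>f \<in> Lip1; bounded (f ` V)\<rbrakk> \<Longrightarrow> f x - f y + \<epsilon> * (laplacian f x - laplacian f y) \<le> b"
  shows "W (walk_measure \<epsilon> x) (walk_measure \<epsilon> y) \<le> b"
  unfolding W_walk_measure[OF assms(1,2)]
proof (rule cSUP_least)
  \<comment> \<open>\<open>cSUP_least\<close> needs a nonempty index set; the zero function is
    admissible.\<close>
  have "(\<lambda>_. 0) \<in> {f \<in> Lip1. bounded (f ` V)}" by (auto simp: Lip1_def bounded_iff)
  then show "{f \<in> Lip1. bounded (f ` V)} \<noteq> {}" by blast
qed (use assms in auto)

text \<open>
  As a supremum of affine functions of \<open>\<epsilon>\<close>, the transport distance is convex. This makes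
  \<open>curvature_eps \<epsilon> x y / \<epsilon>\<close> monotone, so that the limit defining \<open>curvature\<close> exists.
\<close>

lemma W_walk_measure_convex:
  assumes "x \<in> V" "y \<in> V" "0 \<le> t" "t \<le> 1" "0 \<le> \<epsilon>"
  shows "W (walk_measure (t * \<epsilon>) x) (walk_measure (t * \<epsilon>) y) \<le>
         (1 - t) * real (d x y) + t * W (walk_measure \<epsilon> x) (walk_measure \<epsilon> y)"
proof (rule W_walk_measure_le)
  fix f assume f: "f \<in> Lip1" "bounded (f ` V)"
  \<comment> \<open>An affine function of the parameter is interpolated between 0, where the
    Lipschitz bound applies, and \<epsilon>, where \<open>W\<close> bounds it.\<close>
  have "f x - f y + t * \<epsilon> * (laplacian f x - laplacian f y) =
    (1 - t) * (f x - f y) + t * (f x - f y + \<epsilon> * (laplacian f x - laplacian f y))"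
    by (simp add: algebra_simps)
  also have "\<dots> \<le> (1 - t) * real (d x y) + t * W (walk_measure \<epsilon> x) (walk_measure \<epsilon> y)"
    using assms f test_value_le[of x y 0 f] test_value_le_W[of x y \<epsilon> f]
    by (intro add_mono mult_left_mono) auto
  finally show "f x - f y + t * \<epsilon> * (laplacian f x - laplacian f y) \<le> \<dots>" .
qed (use assms in auto)

subsection \<open>Curvature\<close>

lemma curvature_eps_eq:
  assumes "x \<in> V" "y \<in> V" "x \<noteq> y"
  shows "curvature_eps \<epsilon> x y =
    (real (d x y) - W (walk_measure \<epsilon> x) (walk_measure \<epsilon> y)) / real (d x y)"
  using assms by (simp add: curvature_eps_def d_eq_0_iff diff_divide_distrib)

lemma curvature_eps_quotient_antimono:
  assumes "x \<in> V" "y \<in> V" "x \<noteq> y" "0 < \<delta>" "\<delta> \<le> \<epsilon>"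
  shows "(1 / \<epsilon>) * curvature_eps \<epsilon> x y \<le> (1 / \<delta>) * curvature_eps \<delta> x y"
proof -
  \<comment> \<open>\<open>t\<close> writes \<delta> as the convex combination of 0 and \<epsilon>
    to which convexity of \<open>W\<close> applies.\<close>
  define t where "t = \<delta> / \<epsilon>"
  have t: "0 < t" "t \<le> 1" "\<delta> = t * \<epsilon>" "0 < \<epsilon>" using assms by (auto simp: t_def)
  have "t * (real (d x y) - W (walk_measure \<epsilon> x) (walk_measure \<epsilon> y)) \<le>
      real (d x y) - W (walk_measure \<delta> x) (walk_measure \<delta> y)"
    using W_walk_measure_convex[of x y t \<epsilon>] assms t by (simp add: algebra_simps)
  then have "t * curvature_eps \<epsilon> x y \<le> curvature_eps \<delta> x y"
    unfolding curvature_eps_eq[OF assms(1-3)] times_divide_eq_right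
    by (rule divide_right_mono) simp
  then have "t * curvature_eps \<epsilon> x y / \<delta> \<le> curvature_eps \<delta> x y / \<delta>"
    using assms by (intro divide_right_mono) auto
  then show ?thesis using t by simp
qed

text \<open>Clamping is 1-Lipschitz on the reals. It is needed because \<open>W\<close> admits only
  bounded test functions, while the distance from a vertex may be unbounded.\<close>

lemma truncation_Lip1:
  assumes "f \<in> Lip1" shows "(\<lambda>z. max (- M) (min M (f z))) \<in> Lip1"
proof -
  have "\<bar>max (- M) (min M a) - max (- M) (min M b)\<bar> \<le> \<bar>a - b\<bar>" for a b :: real by linarith
  then show ?thesis using assms unfolding Lip1_def by (blast intro: order.trans)
qed

lemma curvature_eps_le:
  assumes "x \<in> V" "y \<in> V" "x \<noteq> y" "0 < \<epsilon>" "f \<in> Lip1" "f y - f x = real (d x y)"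
  shows "(1 / \<epsilon>) * curvature_eps \<epsilon> x y \<le> (laplacian f x - laplacian f y) / real (d x y)"
proof -
  define F where "F = insert x (neighbors x) \<union> insert y (neighbors y)"
  have "finite F" using assms by (auto simp: F_def finite_neighbors)
  then have "finite ((\<lambda>z. \<bar>f z\<bar>) ` F)" by simp
  then obtain M where M: "\<And>z. z \<in> F \<Longrightarrow> \<bar>f z\<bar> \<le> M"
    by (metis bdd_above_def bdd_above_finite imageI)
  \<comment> \<open>Both Laplacians see only values on \<open>F\<close>, where clamping at
    \<open>M\<close> changes nothing.\<close>
  define h where "h = (\<lambda>z. max (- M) (min M (f z)))"
  \<comment> \<open>The sign is flipped because \<open>f\<close> increases from \<open>x\<close> to
    \<open>y\<close>, whereas \<open>W\<close> tests the measure at \<open>x\<close> minus that at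
    \<open>y\<close>. The zeroth-order term then equals \<open>d x y\<close> and cancels.\<close>
  define g where "g = (\<lambda>z. - h z)"
  have h: "h z = f z" if "z \<in> F" for z
    using M[OF that] by (auto simp: h_def)
  then have g: "g x = - f x" "g y = - f y"
    "laplacian g x = - laplacian f x" "laplacian g y = - laplacian f y"
    using laplacian_cong[of x h f] laplacian_cong[of y h f]
    by (auto simp: g_def laplacian_uminus F_def)
  have "h \<in> Lip1" unfolding h_def by (rule truncation_Lip1[OF assms(5)])
  then have "g \<in> Lip1" by (auto simp: Lip1_def g_def abs_minus_commute)
  moreover have "bounded (g ` V)"
  proof -
    have "\<bar>g z\<bar> \<le> \<bar>M\<bar>" for z unfolding g_def h_def by linarith
    then show ?thesis by (auto simp: bounded_iff)
  qed
  ultimately have "g x - g y + \<epsilon> * (laplacian g x - laplacian g y) \<le>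
      W (walk_measure \<epsilon> x) (walk_measure \<epsilon> y)"
    using assms by (intro test_value_le_W) auto
  then have "(1 / \<epsilon>) * (real (d x y) - W (walk_measure \<epsilon> x) (walk_measure \<epsilon> y)) \<le>
      laplacian f x - laplacian f y"
    using assms(4,6) g by (simp add: field_simps)
  then show ?thesis
    unfolding curvature_eps_eq[OF assms(1-3)] times_divide_eq_right
    by (rule divide_right_mono) simp
qed

text \<open>The quotient increases as \<epsilon> decreases to 0 and is bounded by the right-hand
  side, so it converges to its supremum. Convergence must be shown first, since \<open>Lim\<close>
  is otherwise unspecified.\<close>

lemma curvature_le:
  assumes "x \<in> V" "y \<in> V" "x \<noteq> y" "f \<in> Lip1" "f y - f x = real (d x y)"
  shows "curvature x y \<le> (laplacian f x - laplacian f y) / real (d x y)"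
proof -
  define q where "q = (\<lambda>\<epsilon>. (1 / \<epsilon>) * curvature_eps \<epsilon> x y)"
  define B where "B = (laplacian f x - laplacian f y) / real (d x y)"
  have B: "q \<epsilon> \<le> B" if "0 < \<epsilon>" for \<epsilon>
    using curvature_eps_le assms that by (simp add: q_def B_def)
  have anti: "q \<epsilon> \<le> q \<delta>" if "0 < \<delta>" "\<delta> \<le> \<epsilon>" for \<epsilon> \<delta>
    using curvature_eps_quotient_antimono assms that by (simp add: q_def)
  define L where "L = (SUP \<epsilon>\<in>{0<..}. q \<epsilon>)"
  have bdd: "bdd_above (q ` {0<..})" using B by (intro bdd_aboveI2[of _ q B]) auto
  have "(q \<longlongrightarrow> L) (at_right 0)"
  proof (rule order_tendstoI)
    fix a assume "a < L"
    then obtain \<epsilon> where \<epsilon>: "0 < \<epsilon>" "a < q \<epsilon>"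
      unfolding L_def using less_cSUP_iff[OF _ bdd] by auto
    then have "a < q \<delta>" if "0 < \<delta>" "\<delta> < \<epsilon>" for \<delta> using anti[of \<delta> \<epsilon>] that by simp
    then show "\<forall>\<^sub>F \<delta> in at_right 0. a < q \<delta>"
      using \<epsilon>(1) by (auto simp: eventually_at_right_field)
  next
    fix a assume "L < a"
    moreover have "q \<delta> \<le> L" if "0 < \<delta>" for \<delta>
      unfolding L_def using bdd that by (intro cSUP_upper) auto
    ultimately show "\<forall>\<^sub>F \<delta> in at_right 0. q \<delta> < a"
      by (auto simp: eventually_at_right_field intro!: exI[of _ 1] intro: le_less_trans)
  qed
  then have "curvature x y = L"
    unfolding curvature_def q_def by (intro tendsto_Lim) auto
  moreover have "L \<le> B" unfolding L_def using B by (intro cSUP_least) auto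
  ultimately show ?thesis by (simp add: B_def)
qed

section \<open>Sphere curvatures and Laplacian comparison\<close>

lemma sphere_curvature_le:
  assumes "x0 \<in> V" "y \<in> S x0 (Suc r)"
  obtains x where "x \<in> S x0 r" "(x, y) \<in> adj" "sphere_curvature x0 (Suc r) \<le> curvature x y"
proof -
  define A where "A = {x \<in> S x0 r. (x, y) \<in> adj}"
  have A: "finite A" "A \<noteq> {}"
    using finite_sphere[OF assms(1)] sphere_pred[OF assms] by (auto simp: A_def)
  have "sphere_curvature x0 (Suc r) \<le> (MAX x\<in>A. curvature x y)"
    unfolding sphere_curvature_def A_def diff_Suc_1
    using assms finite_sphere[OF assms(1)] by (intro Min_le) auto
  \<comment> \<open>The maximum over a finite nonempty set is attained, which yields the neighbour
    \<open>x\<close>.\<close>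
  moreover have "(MAX x\<in>A. curvature x y) \<in> (\<lambda>x. curvature x y) ` A"
    using A by (intro Max_in) auto
  ultimately show thesis using that by (auto simp: A_def)
qed

text \<open>Induction on the radius: each outward step along an edge of maximal curvature lowers the
  Laplacian of the distance by at least the sphere curvature. At radius 0 the sum is empty and the
  degree bound suffices.\<close>

lemma laplacian_distance_comparison:
  assumes "x0 \<in> V" "y \<in> S x0 R"
  shows "laplacian (\<lambda>z. real (d x0 z)) y \<le> Deg x0 - (\<Sum>r=1..R. sphere_curvature x0 r)"
  using assms(2)
proof (induction R arbitrary: y)
  case 0
  then have "y = x0" using assms by (auto simp: S_def d_eq_0_iff)
  then show ?case
    using abs_laplacian_le_Deg[OF d_in_Lip1] assms by fastforce
next
  case (Suc R)
  obtain x where x: "x \<in> S x0 R" "(x, y) \<in> adj" "sphere_curvature x0 (Suc R) \<le> curvature x y"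
    using sphere_curvature_le[OF assms(1) Suc.prems] .
  \<comment> \<open>On an edge the denominator in \<open>curvature_le\<close> is 1, and the distance
    from \<open>x0\<close> grows by exactly that amount.\<close>
  have "d x y = 1" "x \<noteq> y" using d_adj[OF x(2)] by auto
  then have "curvature x y \<le>
      laplacian (\<lambda>z. real (d x0 z)) x - laplacian (\<lambda>z. real (d x0 z)) y"
    using curvature_le[of x y "\<lambda>z. real (d x0 z)"] d_in_Lip1[OF assms(1)] x(1) Suc.prems
    by (auto simp: S_def)
  then show ?case using Suc.IH[OF x(1)] x(3) by simp
qed

text \<open>One \<open>D\<close> bounds \<open>Deg x0\<close> from the comparison, the other bounds
  \<open>Deg y\<close> from the lower estimate of the Laplacian at any \<open>y\<close> on the
  sphere of radius \<open>R\<close>. The result is independent of \<open>R\<close>.\<close>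

lemma sum_sphere_curvature_le:
  assumes "x0 \<in> V" "infinite V" "\<And>x. x \<in> V \<Longrightarrow> Deg x \<le> D"
  shows "(\<Sum>r=1..R. sphere_curvature x0 r) \<le> 2 * D"
proof -
  obtain y where y: "y \<in> S x0 R" using sphere_nonempty[OF assms(1,2)] by blast
  then have "y \<in> V" by (simp add: S_def)
  then show ?thesis
    using laplacian_distance_comparison[OF assms(1) y]
      abs_laplacian_le_Deg[OF d_in_Lip1[OF assms(1)], of y] assms(3)[of y] assms(3)[OF assms(1)]
    by linarith
qed

lemma limsup_sum_sphere_curvature:
  assumes "x0 \<in> V" "infinite V" bounded_degree
  shows "limsup (\<lambda>R. ereal (\<Sum>r=1..R. sphere_curvature x0 r)) < \<infinity>"
proof -
  obtain D where D: "\<And>x. x \<in> V \<Longrightarrow> Deg x \<le> D"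
    using assms(3) by (auto simp: bounded_degree_def bdd_above_def)
  have "limsup (\<lambda>R. ereal (\<Sum>r=1..R. sphere_curvature x0 r)) \<le> ereal (2 * D)"
    using sum_sphere_curvature_le[OF assms(1,2) D] by (intro Limsup_bounded always_eventually) simp
  then show ?thesis by (auto intro: le_less_trans)
qed

end

theorem corollary4p16:
  shows "(\<forall>(V :: 'a set) w m x0.
            weighted_graph V w m \<and> infinite V \<and> weighted_graph.bounded_degree V w m \<and> x0 \<in> V \<longrightarrow>
            limsup (\<lambda>R. ereal (\<Sum>r=1..R. weighted_graph.sphere_curvature V w m x0 r)) < \<infinity>)
       \<and> \<not> (\<exists>(V :: 'a set) w m x0.
            weighted_graph V w m \<and> infinite V \<and> weighted_graph.bounded_degree V w m \<and> x0 \<in> V \<and>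
            limsup (\<lambda>R. ereal (\<Sum>r=1..R. weighted_graph.sphere_curvature V w m x0 r)) = \<infinity>)"
  using weighted_graph.limsup_sum_sphere_curvature by (metis less_irrefl)

end
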